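(* The following hold: (i) The set of all quadratic algebraic integers in $\mathbb{R}$ is equal to the disjoint union $$\biguplus_{n \in \mathbb{Z},\ \varepsilon \in \{-1,+1\}} \left(\varepsilon S^{2,r} + n\right)$$ (that is, it is the union of these sets, and the sets $\varepsilon S^{2,r}+n$ for distinct pairs $(n,\varepsilon)$ are pairwise disjoint). (ii) In particular, $S^{2,r}$ includes a primitive element (over $\mathbb{Q}$) of any real quadratic field.
   Context: A quadratic algebraic integer is an algebraic integer of degree exactly two over $\mathbb{Q}$. A real quadratic field is a subfield of $\mathbb{R}$ of degree two over $\mathbb{Q}$. For an integer $n \ge 1$, $$I_n^{2,r} := \{\alpha \in (0,1) \mid \alpha^2+n\alpha+c=0 \text{ for some } c \in \mathbb{Z},\ -n \le c \le -1\},$$ and $$S^{2,r} := \bigcup_{n \ge 1} I_n^{2,r}.$$ For a set $S \subset \mathbb{C}$ and an integer $n$: $+S := S$, $-S := \{-\alpha \mid \alpha \in S\}$ and $S+n := \{\alpha+n \mid \alpha \in S\}$; $\varepsilon S$ means $+S$ for $\varepsilon=+1$ and $-S$ for $\varepsilon=-1$. *)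

theory Defs
  imports
    "HOL-Algebra.Algebraic_Closure_Type"
    "HOL-Algebra.Finite_Extensions"
    "HOL-Algebra.Generated_Fields"
    "HOL-Library.Disjoint_Sets"
begin

abbreviation real_ring :: "real ring" where
  "real_ring \<equiv> ring_of_type_algebra"

(* Irr is the monic minimal polynomial, as a list of coefficients with the leading one first.
   It is a definite description, meaningful only for algebraic numbers; these are the only
   arguments to which the degree is applied below. *)
definition degree_over_rat :: "real \<Rightarrow> nat" where
  "degree_over_rat \<alpha> = Polynomials.degree (ring.Irr real_ring \<rat> \<alpha>)"

definition quadratic_algebraic_integer :: "real \<Rightarrow> bool" where
  "quadratic_algebraic_integer \<alpha> \<longleftrightarrow> algebraic_int \<alpha> \<and> degree_over_rat \<alpha> = 2"

definition real_quadratic_field :: "real set \<Rightarrow> bool" where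
  "real_quadratic_field K \<longleftrightarrow> subfield K real_ring \<and> ring.dimension real_ring 2 \<rat> K"

definition primitive_element :: "real set \<Rightarrow> real \<Rightarrow> bool" where
  "primitive_element K \<alpha> \<longleftrightarrow> generate_field real_ring (insert \<alpha> \<rat>) = K"

definition I2r :: "int \<Rightarrow> real set" where
  "I2r n = {\<alpha> \<in> {0<..<1}. \<exists>c::int. - n \<le> c \<and> c \<le> - 1 \<and>
              \<alpha>\<^sup>2 + of_int n * \<alpha> + of_int c = 0}"

definition S2r :: "real set" where
  "S2r = (\<Union>n\<in>{1..}. I2r n)"

definition signed_set :: "int \<Rightarrow> real set \<Rightarrow> real set" where
  "signed_set \<epsilon> S = (if \<epsilon> = - 1 then uminus ` S else S)"

definition shifted_set :: "real set \<Rightarrow> int \<Rightarrow> real set" where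
  "shifted_set S n = (\<lambda>\<alpha>. \<alpha> + of_int n) ` S"

end

theory Submission
  imports Defs
begin

text \<open>
  Let \<open>x\<close> be an irrational root of an integral monic quadratic and \<open>y\<close> its fractional part, with
  conjugate \<open>y'\<close>. Since \<open>y * y'\<close> is a non-zero integer and \<open>0 < y < 1\<close>, either \<open>y' < 0\<close> or \<open>y' > 1\<close>.
  In the first case \<open>y\<close> lies in \<open>S2r\<close>, in the second \<open>1 - y\<close> does. Elements of \<open>S2r\<close> have
  negative trace, whereas the traces of \<open>a\<close> and \<open>1 - a\<close> add up to two; so they are never both
  in \<open>S2r\<close>, which gives disjointness. That the minimal polynomial of a quadratic algebraic
  integer is integral is Gauss' lemma. In a real quadratic field, a suitable non-zero integer
  multiple of any irrational element is, up to sign and an integer shift, in \<open>S2r\<close>.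
\<close>

section \<open>Integral polynomials and Gauss' lemma\<close>

lemma of_int_poly_add:
  "(map_poly of_int (p + q) :: 'a::ring_char_0 poly) = map_poly of_int p + map_poly of_int q"
  by (rule poly_eqI) (simp add: coeff_map_poly)

lemma of_int_poly_smult:
  "(map_poly of_int (smult a q) :: 'a::{comm_ring_1,ring_char_0} poly) =
    smult (of_int a) (map_poly of_int q)"
  by (rule poly_eqI) (simp add: coeff_map_poly)

lemma of_int_poly_mult:
  "(map_poly of_int (p * q) :: 'a::{comm_ring_1,ring_char_0} poly) =
    map_poly of_int p * map_poly of_int q"
  by (induction p) (simp_all add: of_int_poly_add of_int_poly_smult map_poly_pCons)

lemma irrational_root_of_linear:
  fixes a :: real
  assumes "a \<notin> \<rat>" "u \<in> \<rat>" "v \<in> \<rat>" "u * a + v = 0"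
  shows "u = 0" "v = 0"
proof -
  show "u = 0"
  proof (rule ccontr)
    assume "u \<noteq> 0"
    then have "a = - v / u" using assms(4) by (simp add: field_simps)
    then show False using assms by (metis Rats_divide Rats_minus_iff)
  qed
  then show "v = 0" using assms(4) by simp
qed

text \<open>Dividing a monic integral annihilator of \<open>x\<close> by \<open>m\<close> leaves no
  remainder, by minimality of the degree of \<open>m\<close>. Comparing contents then shows that
  \<open>m\<close> divides it over the integers, so \<open>lead_coeff m\<close> divides 1.\<close>

lemma is_unit_lead_coeff_of_primitive_annihilator:
  fixes x :: real
  assumes int: "algebraic_int x"
    and m: "content m = 1" "poly (map_poly of_int m) x = 0"
    and min: "\<And>r :: int poly. r \<noteq> 0 \<Longrightarrow> Polynomial.degree r < Polynomial.degree m \<Longrightarrow>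
                 poly (map_poly of_int r) x \<noteq> 0"
  shows "is_unit (lead_coeff m)"
proof -
  obtain p :: "int poly" where p: "poly (map_poly of_int p) x = 0" "lead_coeff p = 1"
    using int by (auto simp: algebraic_int_altdef_ipoly)
  have m0: "m \<noteq> 0" using m by auto
  \<comment> \<open>Pseudo-division stays within integer polynomials, at the price of a factor
    \<open>a\<close> on \<open>p\<close>.\<close>
  define r where "r = pseudo_mod p m"
  obtain a q where aq: "a \<noteq> 0" "smult a p = m * q + r"
    using pseudo_mod(1)[OF m0] unfolding r_def by blast
  have r_deg: "r = 0 \<or> Polynomial.degree r < Polynomial.degree m"
    using pseudo_mod(2)[OF m0] unfolding r_def by blast
  have "poly (map_poly of_int (smult a p)) x = (0::real)"
    using p by (simp add: of_int_poly_smult)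
  then have "poly (map_poly of_int r) x = 0"
    unfolding aq(2) by (simp add: of_int_poly_add of_int_poly_mult m(2))
  then have r0: "r = 0" using min r_deg by blast
  have "content p dvd lead_coeff p" by (rule content_dvd_coeff)
  then have "content p = 1" using p(2)
    by (metis is_unit_content_iff)
  \<comment> \<open>Content is multiplicative and both \<open>p\<close> and \<open>m\<close> have
    content 1, so \<open>a\<close> can be cancelled from \<open>q\<close>.\<close>
  then have "content q = normalize a"
    using arg_cong[OF aq(2), of content] m(1) by (simp add: r0 content_mult)
  then have "[:a:] dvd q" by (simp add: const_poly_dvd_iff_dvd_content)
  then obtain q' where "q = smult a q'" by (auto simp: dvd_def)
  then have "smult a p = smult a (m * q')" using aq(2) r0 by simp
  then have "p = m * q'" using aq(1) by (simp add: poly_eq_iff)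
  then have "lead_coeff m * lead_coeff q' = 1" using p(2) by (simp add: lead_coeff_mult)
  then show ?thesis by (metis dvd_triv_left)
qed

text \<open>Clearing denominators and taking the primitive part gives an integral quadratic
  annihilator. As \<open>x\<close> is irrational, no non-zero polynomial of smaller degree
  annihilates it, so the leading coefficient is a unit and can be divided out.\<close>

lemma monic_quadratic_of_algebraic_int:
  fixes x b c :: real
  assumes "algebraic_int x" "x \<notin> \<rat>" "b \<in> \<rat>" "c \<in> \<rat>" "x\<^sup>2 + b * x + c = 0"
  shows "\<exists>B C :: int. x\<^sup>2 + of_int B * x + of_int C = 0"
proof -
  obtain b1 b2 :: int where b: "b = of_int b1 / of_int b2" "b2 \<noteq> 0"
    using \<open>b \<in> \<rat>\<close> by (auto simp: Rats_eq_int_div_int)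
  obtain c1 c2 :: int where c: "c = of_int c1 / of_int c2" "c2 \<noteq> 0"
    using \<open>c \<in> \<rat>\<close> by (auto simp: Rats_eq_int_div_int)
  \<comment> \<open>\<open>f\<close> is \<open>b2 * c2\<close> times the given quadratic, with the
    constant term listed first.\<close>
  define f where "f = [:b2 * c1, b1 * c2, b2 * c2:]"
  define m where "m = primitive_part f"
  have f0: "f \<noteq> 0" and degf: "Polynomial.degree f = 2" using b c by (auto simp: f_def)
  have f_eq: "f = smult (content f) m" by (simp add: m_def)
  have "poly (map_poly of_int f) x = of_int (b2 * c2) * (x\<^sup>2 + b * x + c)"
    using b c by (simp add: f_def map_poly_pCons field_simps power2_eq_square)
  then have fx: "poly (map_poly of_int f) x = 0" using assms by simp
  have mx: "poly (map_poly of_int m) x = 0"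
    using fx f0 by (subst (asm) f_eq) (simp add: of_int_poly_smult)
  have degm: "Polynomial.degree m = 2" using degf f0 by (subst (asm) f_eq) simp
  have "is_unit (lead_coeff m)"
  proof (rule is_unit_lead_coeff_of_primitive_annihilator[OF assms(1) _ mx])
    show "content m = 1" using f0 by (simp add: m_def)
    fix r :: "int poly" assume r: "r \<noteq> 0" "Polynomial.degree r < Polynomial.degree m"
    then have "Polynomial.degree r \<le> 1" using degm by simp
    then obtain u v where uv: "r = [:v, u:]"
      by (metis (no_types) degree1_coeffs degree_0_id le_neq_implies_less less_one pCons_0_0 degree_eq_zeroE)
    show "poly (map_poly of_int r) x \<noteq> 0"
      using irrational_root_of_linear[OF \<open>x \<notin> \<rat>\<close>, of "of_int u" "of_int v"] r uv
      by (auto simp: map_poly_pCons algebra_simps)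
  qed
  moreover obtain c0 c1 c2 where m_eq: "m = [:c0, c1, c2:]"
  proof
    show "m = [:coeff m 0, coeff m 1, coeff m 2:]"
      by (rule poly_eqI)
        (use degm in \<open>auto simp: coeff_pCons coeff_eq_0 numeral_2_eq_2 split: nat.splits\<close>)
  qed
  ultimately obtain e where e: "c2 * e = 1"
    using degm by (auto simp: dvd_def numeral_2_eq_2)
  have "of_int c2 * x\<^sup>2 + of_int c1 * x + of_int c0 = 0"
    using mx by (simp add: m_eq map_poly_pCons algebra_simps power2_eq_square)
  then have "of_int e * (of_int c2 * x\<^sup>2 + of_int c1 * x + of_int c0) = 0" by simp
  then have "of_int (c2 * e) * x\<^sup>2 + of_int (e * c1) * x + of_int (e * c0) = 0"
    by (simp add: algebra_simps)
  then have "x\<^sup>2 + of_int (e * c1) * x + of_int (e * c0) = 0" by (simp only: e of_int_1 mult_1)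
  then show ?thesis by blast
qed

lemma algebraic_int_of_monic_quadratic:
  fixes x :: real
  assumes "x\<^sup>2 + of_int b * x + of_int c = 0"
  shows "algebraic_int x"
proof (rule algebraic_int.intros)
  show "lead_coeff [:of_int c, of_int b, 1 :: real:] = 1" by simp
  show "\<forall>i. coeff [:of_int c, of_int b, 1 :: real:] i \<in> \<int>"
    by (auto simp: coeff_pCons split: nat.splits)
  show "poly [:of_int c, of_int b, 1:] x = 0"
    using assms by (simp add: algebra_simps power2_eq_square)
qed

section \<open>Signed shifts of \<open>S2r\<close>: covering and disjointness\<close>

lemma S2rE:
  assumes "x \<in> S2r"
  obtains n c where "1 \<le> n" "0 < x" "x < 1" "x \<notin> \<rat>" "x\<^sup>2 + of_int n * x + of_int c = 0"
proof -
  obtain n c where n: "1 \<le> n" "0 < x" "x < 1" "x\<^sup>2 + of_int n * x + of_int c = 0"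
    using assms by (auto simp: S2r_def I2r_def)
  \<comment> \<open>There is no integer strictly between 0 and 1, and a rational algebraic integer
    is an integer.\<close>
  have "x \<notin> \<int>" using n by (auto elim!: Ints_cases)
  then have "x \<notin> \<rat>"
    using rational_algebraic_int_is_int[OF algebraic_int_of_monic_quadratic[OF n(4)]] by blast
  then show thesis using that n by blast
qed

lemma signed_shiftedE:
  assumes "x \<in> shifted_set (signed_set e S2r) n" "e \<in> {- 1, 1}"
  obtains a where "a \<in> S2r" "x = of_int e * a + of_int n"
  using assms by (fastforce simp: shifted_set_def signed_set_def)

lemma signed_shiftedI:
  assumes "a \<in> S2r" "e \<in> {- 1, 1}" "x = of_int e * a + of_int n"
  shows "x \<in> shifted_set (signed_set e S2r) n"
  using assms by (auto simp: shifted_set_def signed_set_def)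

lemma signed_shifted_imp_monic_quadratic:
  assumes "x \<in> shifted_set (signed_set e S2r) n" "e \<in> {- 1, 1}"
  shows "x \<notin> \<rat>" "\<exists>b c :: int. x\<^sup>2 + of_int b * x + of_int c = 0"
proof -
  obtain a where a: "a \<in> S2r" "x = of_int e * a + of_int n" by (rule signed_shiftedE[OF assms])
  obtain k c where k: "a \<notin> \<rat>" "a\<^sup>2 + of_int k * a + of_int c = 0" by (rule S2rE[OF a(1)])
  have a_eq: "a = of_int e * (x - of_int n)" using assms(2) a(2) by auto
  show "x \<notin> \<rat>" using k(1) a_eq by (metis Rats_diff Rats_mult Rats_of_int)
  \<comment> \<open>The coefficients come from substituting \<open>a = e * (x - n)\<close> and using
    \<open>e * e = 1\<close>.\<close>
  have "x\<^sup>2 + of_int (e * k - 2 * n) * x + of_int (n\<^sup>2 - e * k * n + c) =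
      a\<^sup>2 + of_int k * a + of_int c"
    using assms(2) by (auto simp: a(2) algebra_simps power2_eq_square)
  then show "\<exists>b c :: int. x\<^sup>2 + of_int b * x + of_int c = 0" using k(2) by metis
qed

lemma irrational_monic_quadratic_imp_signed_shifted:
  fixes x :: real
  assumes irr: "x \<notin> \<rat>" and eq: "x\<^sup>2 + of_int b * x + of_int c = 0"
  shows "\<exists>n. \<exists>e\<in>{- 1, 1}. x \<in> shifted_set (signed_set e S2r) n"
proof -
  define y where "y = frac x"
  define N where "N = b + 2 * \<lfloor>x\<rfloor>"
  define M where "M = \<lfloor>x\<rfloor>\<^sup>2 + b * \<lfloor>x\<rfloor> + c"
  have x_eq: "x = y + of_int \<lfloor>x\<rfloor>" by (simp add: y_def frac_def)
  have y_irr: "y \<notin> \<rat>" using irr x_eq by (metis Rats_add Rats_of_int)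
  then have "y \<noteq> 0" by auto
  then have y: "0 < y" "y < 1" using frac_ge_0[of x] frac_lt_1[of x] by (simp_all add: y_def)
  have "y\<^sup>2 + of_int N * y + of_int M = x\<^sup>2 + of_int b * x + of_int c"
    unfolding N_def M_def by (subst (2 4) x_eq) (simp add: algebra_simps power2_eq_square)
  then have yq: "y\<^sup>2 + of_int N * y + of_int M = 0" using eq by simp
  \<comment> \<open>Both cases turn on the sign of the conjugate \<open>M / y = - N - y\<close> of \<open>y\<close>.\<close>
  have prod: "(1 - y) * (1 + of_int N + y) = of_int (1 + N + M)"
    using yq by (simp add: algebra_simps power2_eq_square)
  have conj: "y * (- of_int N - y) = of_int M"
    using yq by (simp add: algebra_simps power2_eq_square)
  consider "M < 0" | "M = 0" | "M > 0" by linarith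
  then show ?thesis
  proof cases
    case 1
    then have "of_int M < (0 :: real)" by simp
    then have "- of_int N - y < 0" using y conj
      by (metis not_less mult_nonneg_nonneg less_imp_le)
    \<comment> \<open>The factor \<open>1 + N + y\<close> is 1 minus the conjugate, hence positive.
      The resulting bound \<open>- N \<le> M\<close> is the lower bound on the constant term in
      \<open>I2r\<close>; together with \<open>M < 0\<close> it also forces
      \<open>N \<ge> 1\<close>.\<close>
    then have "of_int (1 + N + M) > (0 :: real)" using y by (subst prod[symmetric]) simp
    then have "1 + N + M > 0" by linarith
    then have "y \<in> S2r" using 1 y yq unfolding S2r_def I2r_def
      by (auto intro!: bexI[of _ N] exI[of _ M])
    then have "x \<in> shifted_set (signed_set 1 S2r) \<lfloor>x\<rfloor>"
      by (rule signed_shiftedI) (use x_eq in auto)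
    then show ?thesis by blast
  next
    case 2
    then have "y + of_int N = 0" using conj y by auto
    then have "y = of_int (- N)" by simp
    then show ?thesis using y_irr by (metis Rats_of_int)
  next
    case 3
    then have "of_int M \<ge> (1 :: real)" by simp
    \<comment> \<open>A conjugate of at most 1 would make the product \<open>M\<close> at most
      \<open>y\<close>, hence less than 1.\<close>
    then have "- of_int N - y > 1"
      using y conj mult_left_mono[of "- of_int N - y" 1 y] by linarith
    then have "of_int (1 + N + M) < (0 :: real)" using y
      by (subst prod[symmetric]) (simp add: mult_pos_neg)
    then have "1 + N + M < 0" by linarith
    \<comment> \<open>The new coefficients are minus the trace and the norm of \<open>1 - y\<close>.
      Here \<open>M \<ge> 1\<close> is exactly the lower bound on the constant term.\<close>
    moreover have "(1 - y)\<^sup>2 + of_int (- N - 2) * (1 - y) + of_int (1 + N + M) = 0"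
      using yq by (simp add: algebra_simps power2_eq_square)
    ultimately have "1 - y \<in> S2r" using 3 y unfolding S2r_def I2r_def
      by (intro UN_I[of "- N - 2"]) (auto intro!: exI[of _ "1 + N + M"])
    \<comment> \<open>Replacing \<open>y\<close> by \<open>- (1 - y)\<close> lowers it by one, which
      the shift makes up for.\<close>
    then have "x \<in> shifted_set (signed_set (- 1) S2r) (\<lfloor>x\<rfloor> + 1)"
      by (rule signed_shiftedI) (use x_eq in auto)
    then show ?thesis by blast
  qed
qed

text \<open>Subtracting the two quadratic equations cancels the squares. The remaining linear
  relation has the positive coefficient \<open>n + m + 2\<close>, impossible for an irrational
  \<open>a\<close>.\<close>

lemma S2r_disjoint_one_minus:
  assumes "a \<in> S2r" shows "1 - a \<notin> S2r"
proof
  assume "1 - a \<in> S2r"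
  then obtain m d where m: "1 \<le> m" "(1 - a)\<^sup>2 + of_int m * (1 - a) + of_int d = 0"
    by (rule S2rE)
  obtain n c where n: "1 \<le> n" "a \<notin> \<rat>" "a\<^sup>2 + of_int n * a + of_int c = 0"
    by (rule S2rE[OF assms])
  have "of_int (n + m + 2) * a + of_int (c - d - m - 1) = 0"
    using m(2) n(3) by (simp add: algebra_simps power2_eq_square)
  then have "real_of_int (n + m + 2) = 0"
    using irrational_root_of_linear(1)[OF n(2)] by (metis Rats_of_int)
  then show False using m(1) n(1) by linarith
qed

lemma disjoint_signed_shifted:
  "disjoint_family_on (\<lambda>(n, e). shifted_set (signed_set e S2r) n) (UNIV \<times> {- 1, 1})"
proof -
  \<comment> \<open>Opposite signs: \<open>a + b\<close> is an integer strictly between 0 and 2, so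
    it is 1.\<close>
  have mixed: False if "a \<in> S2r" "b \<in> S2r" "a + of_int m = - b + of_int n" for a b m n
  proof -
    have "a + b = of_int (n - m)" "0 < a + b" "a + b < 2"
      using that by (auto elim!: S2rE)
    then have "n - m = 1" by linarith
    then have "b = 1 - a" using that(3) by simp
    then show False using S2r_disjoint_one_minus that by blast
  qed
  \<comment> \<open>Equal signs: two elements of the open unit interval that differ by an integer
    are equal.\<close>
  have same: "m = n" if "a \<in> S2r" "b \<in> S2r" "a + of_int m = b + of_int n" for a b m n
    using that by (auto elim!: S2rE)
  have "shifted_set (signed_set d S2r) n \<inter> shifted_set (signed_set e S2r) m = {}"
    if de: "d \<in> {- 1, 1}" "e \<in> {- 1, 1}" "(n, d) \<noteq> (m, e)" for n d m e
  proof (rule ccontr)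
    assume "\<not> ?thesis"
    then obtain x where x: "x \<in> shifted_set (signed_set d S2r) n"
        "x \<in> shifted_set (signed_set e S2r) m" by blast
    obtain a where a: "a \<in> S2r" "x = of_int d * a + of_int n" using signed_shiftedE x(1) de(1) .
    obtain b where b: "b \<in> S2r" "x = of_int e * b + of_int m" using signed_shiftedE x(2) de(2) .
    show False
      using de mixed[OF a(1) b(1), of n m] mixed[OF b(1) a(1), of m n]
        same[OF a(1) b(1), of n m] same[OF b(1) a(1), of n m] a(2) b(2)
      by (elim insertE emptyE) simp_all
  qed
  then show ?thesis unfolding disjoint_family_on_def by auto
qed

section \<open>The reals as an algebraic structure, and degree over the rationals\<close>

lemma real_ring_simps [simp]:
  "carrier real_ring = UNIV" "\<zero>\<^bsub>real_ring\<^esub> = 0" "\<one>\<^bsub>real_ring\<^esub> = 1"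
  "x \<oplus>\<^bsub>real_ring\<^esub> y = x + y" "x \<otimes>\<^bsub>real_ring\<^esub> y = x * y"
  by (simp_all add: ring_of_type_algebra_def)

interpretation real_ring: domain real_ring
  by (rule field.axioms(1)) (rule field_from_type_algebra)

lemma real_ring_a_inv [simp]: "\<ominus>\<^bsub>real_ring\<^esub> x = - x"
  by (rule real_ring.minus_equality) simp_all

lemma real_ring_m_inv [simp]: "x \<noteq> 0 \<Longrightarrow> inv\<^bsub>real_ring\<^esub> x = inverse x"
  by (rule real_ring.comm_inv_char) simp_all

lemma subfield_Rats: "subfield \<rat> real_ring"
  by (intro field.subfieldI'[OF field_from_type_algebra] real_ring.subringI) auto

lemmas subring_Rats = subfieldE(1)[OF subfield_Rats]

lemma rat_poly_carrier_iff:
  "p \<in> carrier (\<rat>[X]\<^bsub>real_ring\<^esub>) \<longleftrightarrow> p = [] \<or> set p \<subseteq> \<rat> \<and> hd p \<noteq> 0"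
  by (auto simp: univ_poly_carrier[symmetric] polynomial_def)

text \<open>This connects the two kinds of polynomial: the lists of \<open>real_ring\<close> start
  with the leading coefficient, whereas \<open>Poly\<close> expects the constant term first.\<close>

lemma real_ring_eval: "real_ring.eval p x = poly (Poly (rev p)) x"
proof (induction p rule: rev_induct)
  case (snoc a p)
  then show ?case by (simp add: real_ring.eval_append_aux mult.commute)
qed simp

lemma algebraic_imp_algebraic_over_Rats:
  assumes "algebraic x" shows "(real_ring.algebraic over \<rat>) x"
proof -
  obtain p where p: "\<And>i. coeff p i \<in> \<int>" "p \<noteq> 0" "poly p x = 0"
    using assms by (auto simp: algebraic_def)
  then have "set (coeffs p) \<subseteq> \<rat>" using Ints_subset_Rats by (fastforce simp: coeffs_def)
  then have "rev (coeffs p) \<in> carrier (\<rat>[X]\<^bsub>real_ring\<^esub>)"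
    using p(2) by (simp add: rat_poly_carrier_iff hd_rev last_coeffs_eq_coeff_degree)
  then show ?thesis using p(2,3)
    by (intro real_ring.algebraicI[of "rev (coeffs p)"]) (simp_all add: real_ring_eval)
qed

text \<open>The minimal polynomial divides every rational polynomial that vanishes at
  \<open>x\<close>.\<close>

lemma degree_over_rat_le:
  assumes "p \<in> carrier (\<rat>[X]\<^bsub>real_ring\<^esub>)" "p \<noteq> []" "real_ring.eval p x = 0"
  shows "degree_over_rat x \<le> Polynomials.degree p"
proof -
  have alg: "(real_ring.algebraic over \<rat>) x"
    using real_ring.algebraicI[OF assms(1,2)] assms(3) by simp
  have "real_ring.Irr \<rat> x \<in> carrier (\<rat>[X]\<^bsub>real_ring\<^esub>)"
    using real_ring.IrrE(1)[OF subfield_Rats _ alg] by simp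
  moreover have "real_ring.Irr \<rat> x pdivides\<^bsub>real_ring\<^esub> p"
    using real_ring.Irr_minimal[OF subfield_Rats _ alg assms(1)] assms(3) by simp
  ultimately show ?thesis unfolding degree_over_rat_def
    using real_ring.pdivides_imp_degree_le[OF subring_Rats _ assms(1,2)] by blast
qed

text \<open>The coefficients \<open>b\<close> and \<open>c\<close> are read off the monic minimal
  polynomial. A rational \<open>x\<close> would have degree at most 1, as a root of a linear
  polynomial. Conversely the quadratic bounds the degree by 2, and smaller degrees have to be ruled
  out.\<close>

lemma degree_over_rat_eq_2_iff:
  assumes "algebraic x"
  shows "degree_over_rat x = 2 \<longleftrightarrow> x \<notin> \<rat> \<and> (\<exists>b\<in>\<rat>. \<exists>c\<in>\<rat>. x\<^sup>2 + b * x + c = 0)"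
    (is "?L \<longleftrightarrow> ?R")
proof -
  define p where "p = real_ring.Irr \<rat> x"
  have alg: "(real_ring.algebraic over \<rat>) x" by (rule algebraic_imp_algebraic_over_Rats[OF assms])
  have "p \<in> carrier (\<rat>[X]\<^bsub>real_ring\<^esub>)" "Polynomials.lead_coeff p = 1" and eval_p: "real_ring.eval p x = 0"
    using real_ring.IrrE(1,3,4)[OF subfield_Rats _ alg] by (simp_all add: p_def)
  moreover have "p \<noteq> []"
    using real_ring.IrrE(2)[OF subfield_Rats _ alg]
    by (auto simp: p_def ring_irreducible_def univ_poly_zero)
  ultimately obtain q where p: "p = 1 # q" "set q \<subseteq> \<rat>"
    by (cases p) (simp_all add: rat_poly_carrier_iff)
  have deg: "degree_over_rat x = length q" by (simp add: degree_over_rat_def p(1) flip: p_def)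
  show ?thesis
  proof
    assume ?L
    then obtain b c where q: "q = [b, c]" using deg
      by (auto simp: numeral_2_eq_2 length_Suc_conv)
    have "x\<^sup>2 + b * x + c = 0" using eval_p
      by (simp add: p q real_ring_eval algebra_simps power2_eq_square)
    moreover have "x \<notin> \<rat>"
    proof
      assume "x \<in> \<rat>"
      then have "degree_over_rat x \<le> Polynomials.degree [1, - x]"
        by (intro degree_over_rat_le) (simp_all add: rat_poly_carrier_iff real_ring_eval)
      then show False using \<open>?L\<close> by simp
    qed
    ultimately show ?R using p(2) q by auto
  next
    assume R: ?R
    then obtain b c where bc: "b \<in> \<rat>" "c \<in> \<rat>" "x\<^sup>2 + b * x + c = 0" by blast
    then have "degree_over_rat x \<le> 2"
      using degree_over_rat_le[of "[1, b, c]" x]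
      by (simp add: rat_poly_carrier_iff real_ring_eval algebra_simps power2_eq_square)
    \<comment> \<open>With \<open>q\<close> empty, \<open>p\<close> would be the constant 1, which
      has no root.\<close>
    moreover have "length q \<noteq> 0" using eval_p by (auto simp: p real_ring_eval)
    moreover have "length q \<noteq> 1"
    proof
      assume "length q = 1"
      then obtain b where q: "q = [b]" by (auto simp: length_Suc_conv)
      then have "x = - b" using eval_p by (simp add: p real_ring_eval eq_neg_iff_add_eq_0 add.commute)
      then show False using R p(2) q by auto
    qed
    ultimately show ?L using deg by linarith
  qed
qed

text \<open>This replaces minimal polynomials by the equations that the results on
  \<open>S2r\<close> speak of; Gauss' lemma supplies the integrality of \<open>b\<close> and
  \<open>c\<close>.\<close>

lemma quadratic_algebraic_integer_iff:
  "quadratic_algebraic_integer x \<longleftrightarrow> x \<notin> \<rat> \<and> (\<exists>b c :: int. x\<^sup>2 + of_int b * x + of_int c = 0)"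
proof
  assume "quadratic_algebraic_integer x"
  then show "x \<notin> \<rat> \<and> (\<exists>b c :: int. x\<^sup>2 + of_int b * x + of_int c = 0)"
    unfolding quadratic_algebraic_integer_def
    using degree_over_rat_eq_2_iff monic_quadratic_of_algebraic_int by blast
next
  assume R: "x \<notin> \<rat> \<and> (\<exists>b c :: int. x\<^sup>2 + of_int b * x + of_int c = 0)"
  then have int: "algebraic_int x" using algebraic_int_of_monic_quadratic by blast
  have "degree_over_rat x = 2"
    using R by (subst degree_over_rat_eq_2_iff) (use int in \<open>auto intro: Rats_of_int\<close>)
  with int show "quadratic_algebraic_integer x" by (simp add: quadratic_algebraic_integer_def)
qed

section \<open>Primitive elements of real quadratic fields\<close>

lemma real_quadratic_fieldE:
  assumes "real_quadratic_field K"
  obtains x where "x \<in> K" "x \<notin> \<rat>" "K = {r * x + s | r s. r \<in> \<rat> \<and> s \<in> \<rat>}"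
proof -
  have K: "subfield K real_ring" "real_ring.dimension 2 \<rat> K"
    using assms by (simp_all add: real_quadratic_field_def)
  have one: "1 \<in> K" using subringE(3)[OF subfieldE(1)[OF K(1)]] by simp
  have ind: "real_ring.independent \<rat> [1]"
    by (intro real_ring.li_Cons real_ring.li_Nil) simp_all
  \<comment> \<open>The independent list \<open>[1]\<close> is completed to a basis. Dimension 2
    leaves room for one new vector, whose independence from 1 is its irrationality.\<close>
  obtain Vs where Vs: "length (Vs @ [1]) = 2" "real_ring.independent \<rat> (Vs @ [1])"
      "real_ring.Span \<rat> (Vs @ [1]) = K"
    using real_ring.complete_base[OF subfield_Rats K(2) ind] one by auto
  then obtain x where "Vs = [x]" by (auto simp: length_Suc_conv)
  then have x: "x \<notin> real_ring.Span \<rat> [1]" "real_ring.Span \<rat> [x, 1] = K"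
    using Vs real_ring.independent_backwards(1)[of \<rat> x "[1]"] by auto
  have Span1: "real_ring.Span \<rat> [1] = \<rat>"
    by (auto simp: real_ring.line_extension_mem_iff)
  have K_eq: "K = {r * x + s | r s. r \<in> \<rat> \<and> s \<in> \<rat>}"
  proof -
    have "K = real_ring.line_extension \<rat> x \<rat>" using x(2) Span1 by simp
    then show ?thesis by (simp only: set_eq_iff real_ring.line_extension_mem_iff real_ring_simps) blast
  qed
  have "1 * x + 0 \<in> K" unfolding K_eq using Rats_0 Rats_1 by blast
  then have "x \<in> K" by simp
  then show thesis using that x Span1 K_eq by simp
qed

lemma real_quadratic_field_primitive_in_S2r:
  assumes K: "real_quadratic_field K"
  shows "\<exists>a\<in>S2r. primitive_element K a"
proof -
  obtain x where x: "x \<in> K" "x \<notin> \<rat>" and K_eq: "K = {r * x + s | r s. r \<in> \<rat> \<and> s \<in> \<rat>}"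
    using real_quadratic_fieldE[OF K] .
  have sub: "subfield K real_ring" using K by (simp add: real_quadratic_field_def)
  note sr = subringE[OF subfieldE(1)[OF sub], simplified]
  have Rats_K: "\<rat> \<subseteq> K"
  proof
    fix s :: real assume "s \<in> \<rat>"
    moreover have "s = 0 * x + s" by simp
    ultimately show "s \<in> K" unfolding K_eq using Rats_0 by blast
  qed
  have "x * x \<in> K" by (rule sr(6)[OF x(1) x(1)])
  then obtain r s where rs: "r \<in> \<rat>" "s \<in> \<rat>" "x * x = r * x + s" unfolding K_eq by blast
  obtain r1 r2 :: int where r: "r = of_int r1 / of_int r2" "r2 \<noteq> 0"
    using \<open>r \<in> \<rat>\<close> by (auto simp: Rats_eq_int_div_int)
  obtain s1 s2 :: int where s: "s = of_int s1 / of_int s2" "s2 \<noteq> 0"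
    using \<open>s \<in> \<rat>\<close> by (auto simp: Rats_eq_int_div_int)
  \<comment> \<open>Multiplying \<open>x\<close> by \<open>r2 * s2\<close> turns its rational
    quadratic equation into a monic integral one, since the coefficients are multiplied by
    \<open>r2 * s2\<close> and its square.\<close>
  define y where "y = of_int (r2 * s2) * x"
  have x_eq: "x = y / of_int (r2 * s2)" using r s by (simp add: y_def)
  have y_irr: "y \<notin> \<rat>" using x(2) x_eq by (metis Rats_divide Rats_of_int)
  have "y\<^sup>2 = (of_int (r2 * s2))\<^sup>2 * (r * x + s)"
    by (simp add: y_def power_mult_distrib power2_eq_square flip: rs(3))
  also have "\<dots> = of_int (r1 * s2) * y + of_int (r2\<^sup>2 * s2 * s1)"
    using r s by (simp add: y_def field_simps power2_eq_square)
  finally have "y\<^sup>2 + of_int (- r1 * s2) * y + of_int (- r2\<^sup>2 * s2 * s1) = 0" by simp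
  then obtain n e where ne: "e \<in> {- 1, 1}" "y \<in> shifted_set (signed_set e S2r) n"
    using irrational_monic_quadratic_imp_signed_shifted[OF y_irr] by blast
  obtain a where a: "a \<in> S2r" "y = of_int e * a + of_int n" by (rule signed_shiftedE[OF ne(2,1)])
  define F where "F = generate_field real_ring (insert a \<rat>)"
  \<comment> \<open>Passing from \<open>x\<close> to \<open>a\<close> is an invertible affine map
    with rational coefficients, so both generate the same field. This direction gives
    \<open>F \<subseteq> K\<close>; the inverse map below gives \<open>x \<in> F\<close>.\<close>
  have a_eq: "a = of_int e * (of_int (r2 * s2) * x) + of_int (- e * n)"
    using a(2) ne(1) unfolding y_def by auto
  have "a \<in> K" unfolding a_eq using Rats_K x(1) by (intro sr(6,7)) auto
  then have FK: "F \<subseteq> K" unfolding F_def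
    using Rats_K by (intro field.generate_field_min_subfield1[OF field_from_type_algebra _ sub]) auto
  have incl: "t \<in> F" if "t \<in> insert a \<rat>" for t
    using that generate_field.incl unfolding F_def by metis
  have sF: "subfield F real_ring" unfolding F_def
    by (intro field.generate_field_is_subfield[OF field_from_type_algebra]) simp
  note srF = subringE[OF subfieldE(1)[OF sF], simplified]
  have "x = inverse (of_int (r2 * s2)) * (of_int e * a + of_int n)"
    using x_eq a(2) by (simp add: field_simps)
  also have "\<dots> \<in> F" by (intro srF(6,7) incl) auto
  finally have "x \<in> F" .
  then have "K \<subseteq> F" unfolding K_eq by (auto intro!: srF(6,7) intro: incl)
  then show ?thesis using FK a(1) unfolding primitive_element_def F_def by blast
qed

theorem theorem3:
  shows "{\<alpha>. quadratic_algebraic_integer \<alpha>} =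
           (\<Union>(n, \<epsilon>) \<in> (UNIV :: int set) \<times> {- 1, 1}. shifted_set (signed_set \<epsilon> S2r) n)
       \<and> disjoint_family_on (\<lambda>(n, \<epsilon>). shifted_set (signed_set \<epsilon> S2r) n)
           ((UNIV :: int set) \<times> {- 1, 1})
       \<and> (\<forall>K. real_quadratic_field K \<longrightarrow> (\<exists>\<alpha>\<in>S2r. primitive_element K \<alpha>))"
proof (intro conjI disjoint_signed_shifted allI impI real_quadratic_field_primitive_in_S2r)
  show "{\<alpha>. quadratic_algebraic_integer \<alpha>} =
           (\<Union>(n, \<epsilon>) \<in> (UNIV :: int set) \<times> {- 1, 1}. shifted_set (signed_set \<epsilon> S2r) n)"
    using signed_shifted_imp_monic_quadratic irrational_monic_quadratic_imp_signed_shifted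
    unfolding quadratic_algebraic_integer_iff by fast
qed

end
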